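(* Let $\mathbf{S}$ be a canonical single-parameter exponential family. Fix $\nu\in\mathbf{S}$ with mean $\mu$ and standard deviation $\sigma(\mu)$. If $\lim_{\delta\to0}\frac{N_\delta}{\log(1/\delta)}=\infty$, then for any $\pi\in\Pi^{sr}_{\rm CI}$ there is a non-negative constant $q(\mu)$ such that, as $\delta\to0$, $$\frac{\widehat\mu_R^\pi(N_\delta,\delta)-\widehat\mu_L^\pi(N_\delta,\delta)}{\sqrt{\log(1/\delta)/N_\delta}}\ \overset{p}{\to}\ q(\mu)\ \ge\ \sqrt8\,\sigma(\mu).$$
   Context: Exponential family. Fix a reference measure $\xi$ on $\mathbb{R}$. $\mathbf{S}=\{p_\theta:\theta\in\Theta\}$, with $\frac{dp_\theta}{d\xi}(x)=\exp(\theta x-b(\theta))$, where $\Theta=\{\theta\in\mathbb{R}:\int|x|e^{\theta x}\,d\xi(x)<\infty\}$ is assumed to be an open interval, and $b$ is a twice differentiable, strictly convex function. The mean of $p_\theta$ is $b'(\theta)$, strictly increasing in $\theta$, so a distribution in $\mathbf{S}$ is determined by its mean. Policies. $X_1,X_2,\dots$ are i.i.d. from $\nu$; $\mathbb{P}_\nu$ is the corresponding probability. A policy $\pi$ assigns to each $n\in\mathbb{N}$ and $\delta\in(0,1)$ an interval $[\widehat\mu_L^\pi(n,\delta),\widehat\mu_R^\pi(n,\delta)]$ whose endpoints are measurable functions of $X_1,\dots,X_n$. $\Pi_{\rm CI}$ is the set of policies such that for every $\nu\in\mathbf{S}$ with mean $\mu$, every $\delta\in(0,1)$ and every $n\in\mathbb{N}$,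 $\mathbb{P}_\nu(\mu\in[\widehat\mu_L^\pi(n,\delta),\widehat\mu_R^\pi(n,\delta)])\ge1-\delta$. Stability. $N_\delta$ is a positive-integer-valued function of $\delta\in(0,1)$ with $N_\delta\to\infty$ as $\delta\to0$. A policy $\pi\in\Pi_{\rm CI}$ is stable (for $\nu$ with mean $\mu$) if, as $\delta\to0$, under $\mathbb{P}_\nu$, $\widehat\mu_L^\pi(N_\delta,\delta)$ and $\widehat\mu_R^\pi(N_\delta,\delta)$ converge in probability to deterministic constants $\mu_L^\pi(\mu)\le\mu$ and $\mu_R^\pi(\mu)\ge\mu$ ($\pm\infty$ allowed). $\Pi^s_{\rm CI}$ is the set of stable policies in $\Pi_{\rm CI}$. Rate stability. $\Pi^{sr}_{\rm CI}\subseteq\Pi^s_{\rm CI}$ is the set of stable policies such that, when $\lim_{\delta\to0}N_\delta/\log(1/\delta)=\infty$, under $\mathbb{P}_\nu$ as $\delta\to0$, $\frac{\mu-\widehat\mu_L^\pi(N_\delta,\delta)}{\sqrt{\log(1/\delta)/N_\delta}}\overset{p}{\to}\theta_L^\pi(\mu)$ and $\frac{\widehat\mu_R^\pi(N_\delta,\delta)-\mu}{\sqrt{\log(1/\delta)/N_\delta}}\overset{p}{\to}\theta_R^\pi(\mu)$, where $\theta_L^\pi(\mu),\theta_R^\pi(\mu)$ are non-negative (finite) constants. *)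

theory Defs
  imports "HOL-Probability.Probability"
begin

definition natural_param_space :: "real measure \<Rightarrow> real set" where
  "natural_param_space \<xi> =
     {\<theta>. (\<integral>\<^sup>+ x. ennreal (\<bar>x\<bar> * exp (\<theta> * x)) \<partial>\<xi>) < \<infinity>}"

definition exp_family_dist :: "real measure \<Rightarrow> (real \<Rightarrow> real) \<Rightarrow> real \<Rightarrow> real measure" where
  "exp_family_dist \<xi> b \<theta> = density \<xi> (\<lambda>x. ennreal (exp (\<theta> * x - b \<theta>)))"

definition strictly_convex_on :: "real set \<Rightarrow> (real \<Rightarrow> real) \<Rightarrow> bool" where
  "strictly_convex_on A f \<longleftrightarrow>
     convex A \<and>
     (\<forall>x\<in>A. \<forall>y\<in>A. \<forall>t. x \<noteq> y \<longrightarrow> 0 < t \<longrightarrow> t < 1 \<longrightarrow>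
        f ((1 - t) * x + t * y) < (1 - t) * f x + t * f y)"

text \<open>
  Requiring every member to be a probability measure makes \<open>b\<close> the log-partition function
  of \<open>\<xi>\<close> on the parameter space; the values of \<open>b\<close> elsewhere are irrelevant.
\<close>

definition canonical_exp_family :: "real measure \<Rightarrow> (real \<Rightarrow> real) \<Rightarrow> bool" where
  "canonical_exp_family \<xi> b \<longleftrightarrow>
     sets \<xi> = sets borel \<and>
     open (natural_param_space \<xi>) \<and> is_interval (natural_param_space \<xi>) \<and>
     (\<forall>\<theta>\<in>natural_param_space \<xi>. prob_space (exp_family_dist \<xi> b \<theta>)) \<and>
     (\<forall>\<theta>\<in>natural_param_space \<xi>.
        b differentiable (at \<theta>) \<and> deriv b differentiable (at \<theta>)) \<and>
     strictly_convex_on (natural_param_space \<xi>) b"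

definition exp_family :: "real measure \<Rightarrow> (real \<Rightarrow> real) \<Rightarrow> real measure set" where
  "exp_family \<xi> b = exp_family_dist \<xi> b ` natural_param_space \<xi>"

definition mean :: "real measure \<Rightarrow> real" where
  "mean \<nu> = (\<integral>x. x \<partial>\<nu>)"

definition std_dev :: "real measure \<Rightarrow> real" where
  "std_dev \<nu> = sqrt (\<integral>x. (x - mean \<nu>)\<^sup>2 \<partial>\<nu>)"

text \<open>
  The law of an i.i.d. sequence \<open>X\<^sub>1, X\<^sub>2, \<dots>\<close> from \<open>\<nu>\<close>; \<open>X\<^sub>i\<close> is the \<open>i\<close>-th coordinate.
\<close>

definition iid_seq :: "real measure \<Rightarrow> (nat \<Rightarrow> real) measure" where
  "iid_seq \<nu> = (\<Pi>\<^sub>M i\<in>{1..}. \<nu>)"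

text \<open>
  The endpoints of the interval for sample size \<open>n\<close> and level \<open>\<delta>\<close> are functions on the
  \<open>n\<close>-fold product space. They may be infinite, and no order between them is imposed:
  the interval is empty if the lower endpoint exceeds the upper one.
\<close>

record policy =
  lower :: "nat \<Rightarrow> real \<Rightarrow> (nat \<Rightarrow> real) \<Rightarrow> ereal"
  upper :: "nat \<Rightarrow> real \<Rightarrow> (nat \<Rightarrow> real) \<Rightarrow> ereal"

definition measurable_policy :: "policy \<Rightarrow> bool" where
  "measurable_policy \<pi> \<longleftrightarrow>
     (\<forall>n\<ge>1. \<forall>\<delta>\<in>{0<..<1}.
        lower \<pi> n \<delta> \<in> borel_measurable (\<Pi>\<^sub>M i\<in>{1..n}. borel) \<and>
        upper \<pi> n \<delta> \<in> borel_measurable (\<Pi>\<^sub>M i\<in>{1..n}. borel))"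

definition mu_L :: "policy \<Rightarrow> nat \<Rightarrow> real \<Rightarrow> (nat \<Rightarrow> real) \<Rightarrow> ereal" where
  "mu_L \<pi> n \<delta> X = lower \<pi> n \<delta> (restrict X {1..n})"

definition mu_R :: "policy \<Rightarrow> nat \<Rightarrow> real \<Rightarrow> (nat \<Rightarrow> real) \<Rightarrow> ereal" where
  "mu_R \<pi> n \<delta> X = upper \<pi> n \<delta> (restrict X {1..n})"

definition CI_policies :: "real measure \<Rightarrow> (real \<Rightarrow> real) \<Rightarrow> policy set" where
  "CI_policies \<xi> b =
     {\<pi>. measurable_policy \<pi> \<and>
         (\<forall>\<nu>\<in>exp_family \<xi> b. \<forall>\<delta>\<in>{0<..<1}. \<forall>n\<ge>1.
            measure (iid_seq \<nu>)
              {X \<in> space (iid_seq \<nu>). ereal (mean \<nu>) \<in> {mu_L \<pi> n \<delta> X .. mu_R \<pi> n \<delta> X}}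
            \<ge> 1 - \<delta>)}"

text \<open>
  Convergence in probability to a constant, phrased with neighbourhoods so that infinite
  limits in \<^typ>\<open>ereal\<close> are covered. For a finite limit \<open>c\<close> this is the usual condition that
  the probability of \<open>\<bar>Y i - c\<bar> > \<epsilon>\<close> tends to \<open>0\<close> for all \<open>\<epsilon> > 0\<close>.
\<close>

definition tendsto_in_prob ::
  "'w measure \<Rightarrow> ('i \<Rightarrow> 'w \<Rightarrow> 'a::topological_space) \<Rightarrow> 'a \<Rightarrow> 'i filter \<Rightarrow> bool" where
  "tendsto_in_prob M Y c F \<longleftrightarrow>
     (\<forall>U. open U \<longrightarrow> c \<in> U \<longrightarrow>
        ((\<lambda>i. measure M {w \<in> space M. Y i w \<notin> U}) \<longlongrightarrow> 0) F)"

definition sample_size_fun :: "(real \<Rightarrow> nat) \<Rightarrow> bool" where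
  "sample_size_fun N \<longleftrightarrow>
     (\<forall>\<delta>\<in>{0<..<1}. N \<delta> \<ge> 1) \<and> filterlim N at_top (at_right 0)"

definition stable_policies ::
  "real measure \<Rightarrow> (real \<Rightarrow> real) \<Rightarrow> (real \<Rightarrow> nat) \<Rightarrow> real measure \<Rightarrow> policy set" where
  "stable_policies \<xi> b N \<nu> =
     {\<pi> \<in> CI_policies \<xi> b.
        \<exists>m\<^sub>L m\<^sub>R :: ereal. m\<^sub>L \<le> ereal (mean \<nu>) \<and> ereal (mean \<nu>) \<le> m\<^sub>R \<and>
          tendsto_in_prob (iid_seq \<nu>) (\<lambda>\<delta>. mu_L \<pi> (N \<delta>) \<delta>) m\<^sub>L (at_right 0) \<and>
          tendsto_in_prob (iid_seq \<nu>) (\<lambda>\<delta>. mu_R \<pi> (N \<delta>) \<delta>) m\<^sub>R (at_right 0)}"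

definition ci_rate :: "(real \<Rightarrow> nat) \<Rightarrow> real \<Rightarrow> real" where
  "ci_rate N \<delta> = sqrt (ln (1 / \<delta>) / real (N \<delta>))"

definition rate_stable_policies ::
  "real measure \<Rightarrow> (real \<Rightarrow> real) \<Rightarrow> (real \<Rightarrow> nat) \<Rightarrow> real measure \<Rightarrow> policy set" where
  "rate_stable_policies \<xi> b N \<nu> =
     {\<pi> \<in> stable_policies \<xi> b N \<nu>.
        filterlim (\<lambda>\<delta>. real (N \<delta>) / ln (1 / \<delta>)) at_top (at_right 0) \<longrightarrow>
        (\<exists>\<theta>\<^sub>L \<theta>\<^sub>R :: real. 0 \<le> \<theta>\<^sub>L \<and> 0 \<le> \<theta>\<^sub>R \<and>
          tendsto_in_prob (iid_seq \<nu>)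
            (\<lambda>\<delta> X. (ereal (mean \<nu>) - mu_L \<pi> (N \<delta>) \<delta> X) / ereal (ci_rate N \<delta>))
            (ereal \<theta>\<^sub>L) (at_right 0) \<and>
          tendsto_in_prob (iid_seq \<nu>)
            (\<lambda>\<delta> X. (mu_R \<pi> (N \<delta>) \<delta> X - ereal (mean \<nu>)) / ereal (ci_rate N \<delta>))
            (ereal \<theta>\<^sub>R) (at_right 0))}"

end

theory Submission
  imports Defs "HOL-Real_Asymp.Real_Asymp"
begin

text \<open>
  Write \<open>\<theta>\<close> for the parameter of \<open>\<nu>\<close>, \<open>\<mu> = b' \<theta>\<close> for its mean,
  \<open>v = b'' \<theta>\<close>, \<open>L = ln (1/\<delta>)\<close> and \<open>r = sqrt (L / N \<delta>)\<close> for the rate.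
  Coverage must hold for every member of the family, and members whose means lie within a
  small enough multiple of \<open>r\<close> of \<open>\<mu>\<close> cannot be told apart from \<open>\<nu>\<close> at error level \<open>\<delta>\<close>.

  Consider the alternative \<open>\<theta>' = \<theta> + t r\<close>. Its mean is \<open>\<mu> + v t r + o(r)\<close>,
  and the Kullback--Leibler divergence of \<open>N \<delta>\<close> observations from it, measured under
  \<open>\<nu>\<close>, is \<open>N \<delta> * bregman b \<theta> (t r)\<close>, which is asymptotically
  \<open>L * v t\<^sup>2 / 2\<close> (lemma \<open>bregman_quadratic\<close>). The event that the interval misses the
  mean of \<open>\<theta>'\<close> has probability at most \<open>\<delta> = exp (- L)\<close> under \<open>\<theta>'\<close>.
  When \<open>v t\<^sup>2 / 2 < 1\<close>, the log-likelihood ratio stays below \<open>(1 - \<epsilon>) L\<close> with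
  probability tending to 1, so the same event has vanishing probability under \<open>\<nu>\<close>
  (lemmas \<open>undetectable_alternative\<close> and \<open>exclusion_vanishes\<close>). Hence the upper endpoint, of
  which the normalised distance to \<open>\<mu>\<close> converges in probability, cannot settle below
  \<open>\<mu> + v t r\<close>. Letting \<open>t\<close> increase to \<open>sqrt (2 / v)\<close> gives
  \<open>\<theta>\<^sub>R \<ge> sqrt (2 v)\<close>, and negative \<open>t\<close> gives the same bound for
  \<open>\<theta>\<^sub>L\<close> (lemmas \<open>upper_rate_ge\<close> and \<open>lower_rate_ge\<close>).

  The width divided by \<open>r\<close> is the sum of the two normalised distances, so it converges to
  \<open>q = \<theta>\<^sub>L + \<theta>\<^sub>R \<ge> 2 sqrt (2 v)\<close>. Finally \<open>v \<ge> \<sigma>\<^sup>2\<close>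
  (lemma \<open>variance_p_le\<close>). This inequality and the identity between \<open>b'\<close> and the mean come
  from the elementary bounds \<open>1 + z \<le> exp z\<close> and \<open>z\<^sup>2 \<le> exp z + exp (- z) - 2\<close>
  applied to exponential moments, which are explicit in the family; no derivative is taken
  under the integral sign.
\<close>

section \<open>Change of measure and product measures\<close>

text \<open>
  The right-hand side is \<open>4 * (sinh (z / 2))\<^sup>2\<close>, and \<open>sinh w \<ge> w\<close> for
  \<open>w \<ge> 0\<close>.
\<close>

lemma square_le_exp_sum: "z\<^sup>2 \<le> exp z + exp (- z) - 2" for z :: real
proof -
  have pos: "w \<le> sinh w" if "0 \<le> w" for w :: real
  proof -
    have "sinh 0 - 0 \<le> sinh w - w"
      by (rule DERIV_nonneg_imp_nondecreasing[OF that])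
         (auto intro!: derivative_eq_intros exI simp: cosh_real_ge_1)
    then show ?thesis by simp
  qed
  have "\<bar>z / 2\<bar> \<le> sinh \<bar>z / 2\<bar>" by (rule pos) simp
  then have "\<bar>z / 2\<bar>\<^sup>2 \<le> (sinh \<bar>z / 2\<bar>)\<^sup>2" by (rule power_mono) simp
  also have "(sinh \<bar>z / 2\<bar>)\<^sup>2 = (sinh (z / 2))\<^sup>2" by (auto simp: abs_if simp del: minus_divide_left)
  also have "\<dots> = (exp z + exp (- z) - 2) / 4"
    by (simp add: sinh_field_def power2_eq_square field_simps flip: exp_add)
  finally show ?thesis by (simp add: power2_eq_square)
qed

text \<open>
  Here \<open>g\<close> is the log-likelihood ratio of \<open>M\<close> to the second measure. Where \<open>g \<le> K\<close>, the
  first term pays for the event, because the two measures then differ by a factor of at most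
  \<open>exp K\<close>; where \<open>g > K\<close>, Markov's inequality for the \<open>\<kappa>\<close>-th power of the
  likelihood ratio pays for it.
\<close>

lemma emeasure_le_change_of_measure:
  fixes g :: "'a \<Rightarrow> real"
  assumes [measurable]: "g \<in> borel_measurable M" "A \<in> sets M" and "0 \<le> \<kappa>"
  shows "emeasure M A \<le>
    ennreal (exp K) * emeasure (density M (\<lambda>x. ennreal (exp (- g x)))) A +
    (\<integral>\<^sup>+x. ennreal (exp (\<kappa> * (g x - K))) \<partial>M)"
proof -
  have pt: "indicator A x \<le>
      ennreal (exp K) * (ennreal (exp (- g x)) * indicator A x) + ennreal (exp (\<kappa> * (g x - K)))" for x
  proof (cases "x \<in> A")
    case True
    have "1 \<le> exp (K - g x) + exp (\<kappa> * (g x - K))"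
    proof (cases "g x \<le> K")
      case True
      then have "1 \<le> exp (K - g x)" by simp
      then show ?thesis by (rule order_trans) simp
    next
      case False
      then have "1 \<le> exp (\<kappa> * (g x - K))" using assms(3) by simp
      then show ?thesis by (rule order_trans) simp
    qed
    then have "ennreal 1 \<le> ennreal (exp (K - g x) + exp (\<kappa> * (g x - K)))" by (rule ennreal_leI)
    then show ?thesis
      using True by (simp add: ennreal_plus exp_diff exp_minus divide_inverse ennreal_mult)
  qed simp
  have "emeasure M A = (\<integral>\<^sup>+x. indicator A x \<partial>M)" by simp
  also have "\<dots> \<le> (\<integral>\<^sup>+x. ennreal (exp K) * (ennreal (exp (- g x)) * indicator A x) +
      ennreal (exp (\<kappa> * (g x - K))) \<partial>M)"
    by (intro nn_integral_mono pt)
  also have "\<dots> = ennreal (exp K) * emeasure (density M (\<lambda>x. ennreal (exp (- g x)))) A +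
      (\<integral>\<^sup>+x. ennreal (exp (\<kappa> * (g x - K))) \<partial>M)"
    by (simp add: nn_integral_add nn_integral_cmult emeasure_density)
  finally show ?thesis .
qed

lemma product_prob_space_const: "prob_space M \<Longrightarrow> product_prob_space (\<lambda>_. M)"
  by (simp add: product_prob_space_def product_prob_space_axioms_def product_sigma_finite_def
      prob_space_imp_sigma_finite)

lemma PiM_density:
  fixes f :: "'a \<Rightarrow> ennreal"
  assumes "prob_space M" "prob_space (density M f)" "finite I"
    and [measurable]: "f \<in> borel_measurable M"
  shows "PiM I (\<lambda>_. density M f) = density (PiM I (\<lambda>_. M)) (\<lambda>X. \<Prod>i\<in>I. f (X i))"
proof -
  interpret M: product_prob_space "\<lambda>_. M" by (rule product_prob_space_const) fact
  interpret D: product_prob_space "\<lambda>_. density M f" by (rule product_prob_space_const) fact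
  have meas: "(\<lambda>X. \<Prod>i\<in>I. f (X i)) \<in> borel_measurable (PiM I (\<lambda>_. M))" by measurable
  show ?thesis
  proof (rule D.PiM_eqI[symmetric])
    show "sets (density (PiM I (\<lambda>_. M)) (\<lambda>X. \<Prod>i\<in>I. f (X i))) = sets (PiM I (\<lambda>_. density M f))"
      by (simp cong: sets_PiM_cong)
    fix A assume A: "\<And>i. i \<in> I \<Longrightarrow> A i \<in> sets (density M f)"
    then have [measurable]: "\<And>i. i \<in> I \<Longrightarrow> A i \<in> sets M" by simp
    have "emeasure (density (PiM I (\<lambda>_. M)) (\<lambda>X. \<Prod>i\<in>I. f (X i))) (Pi\<^sub>E I A) =
        (\<integral>\<^sup>+X. (\<Prod>i\<in>I. f (X i)) * indicator (Pi\<^sub>E I A) X \<partial>PiM I (\<lambda>_. M))"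
      using assms(3) by (intro emeasure_density meas sets_PiM_I_finite) auto
    also have "\<dots> = (\<integral>\<^sup>+X. (\<Prod>i\<in>I. f (X i) * indicator (A i) (X i)) \<partial>PiM I (\<lambda>_. M))"
    proof (rule nn_integral_cong)
      fix X assume "X \<in> space (PiM I (\<lambda>_. M))"
      then have "(indicator (Pi\<^sub>E I A) X :: ennreal) = (\<Prod>i\<in>I. indicator (A i) (X i))"
        using assms(3) by (auto simp: indicator_def space_PiM PiE_iff prod_eq_1_iff)
      then show "(\<Prod>i\<in>I. f (X i)) * indicator (Pi\<^sub>E I A) X =
          (\<Prod>i\<in>I. f (X i) * indicator (A i) (X i))"
        by (simp add: prod.distrib)
    qed
    also have "\<dots> = (\<Prod>i\<in>I. \<integral>\<^sup>+x. f x * indicator (A i) x \<partial>M)"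
      using assms(3) by (intro M.product_nn_integral_prod) auto
    also have "\<dots> = (\<Prod>i\<in>I. emeasure (density M f) (A i))"
      by (intro prod.cong refl) (simp add: emeasure_density)
    finally show "emeasure (density (PiM I (\<lambda>_. M)) (\<lambda>X. \<Prod>i\<in>I. f (X i))) (Pi\<^sub>E I A) =
        (\<Prod>i\<in>I. emeasure (density M f) (A i))" .
  qed fact
qed

lemma prob_space_iid_seq: "prob_space \<nu> \<Longrightarrow> prob_space (iid_seq \<nu>)"
  unfolding iid_seq_def by (intro prob_space_PiM)

lemma measurable_restrict_iid_seq:
  assumes "sets \<nu> = sets borel"
  shows "(\<lambda>X. restrict X {1..n}) \<in> iid_seq \<nu> \<rightarrow>\<^sub>M PiM {1..n} (\<lambda>_. borel)"
  unfolding iid_seq_def using assms by (intro measurable_restrict_subset') auto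

text \<open>
  A policy sees only the first \<open>n\<close> observations, so its error probabilities can be computed on
  a finite product, where the likelihood ratio exists. On the infinite product two distinct
  members of the family are mutually singular.
\<close>

lemma measure_iid_seq:
  assumes "prob_space \<nu>" "A \<in> sets (PiM {1..n} (\<lambda>_. \<nu>))"
  shows "measure (iid_seq \<nu>) {X \<in> space (iid_seq \<nu>). restrict X {1..n} \<in> A} =
    measure (PiM {1..n} (\<lambda>_. \<nu>)) A"
proof -
  have "measure (PiM {1..n} (\<lambda>_. \<nu>)) A =
      measure (distr (PiM {1..} (\<lambda>_. \<nu>)) (PiM {1..n} (\<lambda>_. \<nu>)) (\<lambda>x. restrict x {1..n})) A"
    by (subst product_prob_space.distr_PiM_restrict_finite[OF product_prob_space_const])
       (auto simp: assms(1))
  also have "\<dots> = measure (iid_seq \<nu>) {X \<in> space (iid_seq \<nu>). restrict X {1..n} \<in> A}"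
    unfolding iid_seq_def
    by (subst measure_distr[OF measurable_restrict_subset assms(2)])
       (auto intro!: arg_cong[where f = "measure _"])
  finally show ?thesis ..
qed

section \<open>Sums of sequences converging in probability\<close>

lemma tendsto_in_prob_add:
  fixes Y Z W :: "'i \<Rightarrow> 'w \<Rightarrow> ereal"
  assumes "prob_space M"
    and Y: "tendsto_in_prob M Y (ereal a) F" and Z: "tendsto_in_prob M Z (ereal c) F"
    and meas: "\<forall>\<^sub>F i in F. Y i \<in> borel_measurable M \<and> Z i \<in> borel_measurable M"
    and W: "\<forall>\<^sub>F i in F. \<forall>w\<in>space M. W i w = Y i w + Z i w"
  shows "tendsto_in_prob M W (ereal (a + c)) F"
  unfolding tendsto_in_prob_def
proof (intro allI impI)
  interpret prob_space M by fact
  fix U :: "ereal set" assume U: "open U" "ereal (a + c) \<in> U"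
  \<comment> \<open>Addition on the extended reals is continuous at a pair of finite points.\<close>
  have "((\<lambda>(x, y). x + y) \<longlongrightarrow> ereal a + ereal c) (nhds (ereal a) \<times>\<^sub>F nhds (ereal c))"
    unfolding case_prod_beta by (intro tendsto_add_ereal filterlim_fst filterlim_snd) auto
  then have "\<forall>\<^sub>F z in nhds (ereal a) \<times>\<^sub>F nhds (ereal c). (case z of (x, y) \<Rightarrow> x + y) \<in> U"
    using U by (auto dest: topological_tendstoD)
  then obtain U1 U2 where U12: "open U1" "ereal a \<in> U1" "open U2" "ereal c \<in> U2"
      "\<And>x y. x \<in> U1 \<Longrightarrow> y \<in> U2 \<Longrightarrow> x + y \<in> U"
    unfolding eventually_prod_filter eventually_nhds by (metis case_prod_conv)
  show "((\<lambda>i. measure M {w \<in> space M. W i w \<notin> U}) \<longlongrightarrow> 0) F"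
  proof (rule tendsto_sandwich[OF _ _ tendsto_const])
    show "((\<lambda>i. measure M {w \<in> space M. Y i w \<notin> U1} + measure M {w \<in> space M. Z i w \<notin> U2}) \<longlongrightarrow> 0) F"
      using Y Z U12 unfolding tendsto_in_prob_def by (intro tendsto_add_zero) auto
    show "\<forall>\<^sub>F i in F. measure M {w \<in> space M. W i w \<notin> U} \<le>
        measure M {w \<in> space M. Y i w \<notin> U1} + measure M {w \<in> space M. Z i w \<notin> U2}"
      using meas W
    proof eventually_elim
      case (elim i)
      then have [measurable]: "Y i \<in> borel_measurable M" "Z i \<in> borel_measurable M" by auto
      have [measurable]: "U1 \<in> sets borel" "U2 \<in> sets borel" using U12 by auto
      have "measure M {w \<in> space M. W i w \<notin> U} \<le>
          measure M ({w \<in> space M. Y i w \<notin> U1} \<union> {w \<in> space M. Z i w \<notin> U2})"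
        using elim U12(5) by (intro finite_measure_mono) auto
      also have "\<dots> \<le> measure M {w \<in> space M. Y i w \<notin> U1} + measure M {w \<in> space M. Z i w \<notin> U2}"
        by (intro measure_Un_le) measurable
      finally show ?case .
    qed
  qed (auto intro: always_eventually)
qed

section \<open>Exponential moments, mean and variance\<close>

text \<open>
  The Bregman divergence of \<open>b\<close>. In an exponential family it is the Kullback--Leibler divergence
  of the member at \<open>\<theta> + u\<close> from the member at \<open>\<theta>\<close>, with expectation under
  \<open>\<theta>\<close>; it is also the logarithm of the centred moment generating function at \<open>u\<close>.
\<close>

definition bregman :: "(real \<Rightarrow> real) \<Rightarrow> real \<Rightarrow> real \<Rightarrow> real" where
  "bregman b \<theta> u = b (\<theta> + u) - b \<theta> - u * deriv b \<theta>"

context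
  fixes \<xi> :: "real measure" and b :: "real \<Rightarrow> real"
  assumes fam: "canonical_exp_family \<xi> b"
begin

abbreviation \<Theta> where "\<Theta> \<equiv> natural_param_space \<xi>"
abbreviation p where "p \<equiv> exp_family_dist \<xi> b"

lemma sets_ref [simp, measurable_cong]: "sets \<xi> = sets borel"
  using fam by (simp add: canonical_exp_family_def)

lemma sets_p [simp, measurable_cong]: "sets (p \<theta>) = sets borel"
  by (simp add: exp_family_dist_def)

lemma space_p [simp]: "space (p \<theta>) = UNIV"
  using sets_eq_imp_space_eq[OF sets_p] by simp

lemma prob_space_p: "\<theta> \<in> \<Theta> \<Longrightarrow> prob_space (p \<theta>)"
  using fam by (simp add: canonical_exp_family_def)

lemma DERIV_b: "\<theta> \<in> \<Theta> \<Longrightarrow> (b has_real_derivative deriv b \<theta>) (at \<theta>)"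
  using fam by (simp add: canonical_exp_family_def DERIV_deriv_iff_real_differentiable)

lemma DERIV_b_shift:
  assumes "\<theta> + u \<in> \<Theta>"
  shows "((\<lambda>u. b (\<theta> + u)) has_real_derivative deriv b (\<theta> + u)) (at u)"
  using DERIV_b[OF assms] DERIV_shift[of b "deriv b (\<theta> + u)" u \<theta>] by (simp add: add.commute)

lemma DERIV_bregman:
  assumes "\<theta> + u \<in> \<Theta>"
  shows "(bregman b \<theta> has_real_derivative (deriv b (\<theta> + u) - deriv b \<theta>)) (at u)"
  unfolding bregman_def[abs_def]
  by (rule derivative_eq_intros DERIV_b_shift[OF assms] refl)+ simp

lemma DERIV_deriv_b: "\<theta> \<in> \<Theta> \<Longrightarrow> (deriv b has_real_derivative deriv (deriv b) \<theta>) (at \<theta>)"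
  using fam by (simp add: canonical_exp_family_def DERIV_deriv_iff_real_differentiable)

lemma eventually_param: 
  assumes "\<theta> \<in> \<Theta>" "(f \<longlongrightarrow> 0) F"
  shows "\<forall>\<^sub>F i in F. \<theta> + f i \<in> \<Theta>"
proof -
  have "open \<Theta>" using fam by (simp add: canonical_exp_family_def)
  moreover have "((\<lambda>i. \<theta> + f i) \<longlongrightarrow> \<theta>) F"
    using tendsto_add[OF tendsto_const assms(2), of \<theta>] by simp
  ultimately show ?thesis using assms(1) by (simp add: tendsto_def)
qed

text \<open>
  Every member of the family is an exponential tilt of any other, so likelihood
  ratios and moments can be computed without returning to the reference measure.
\<close>

lemma density_p:
  "p (\<theta> + u) = density (p \<theta>) (\<lambda>x. ennreal (exp (u * x - (b (\<theta> + u) - b \<theta>))))"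
  unfolding exp_family_dist_def
  by (subst density_density_eq) (auto simp: ring_distribs simp flip: ennreal_mult exp_add
      intro!: density_cong)

text \<open>
  The density of the tilted member has total mass 1, and this evaluates the moment generating
  function.
\<close>

lemma nn_integral_exp_p:
  assumes "\<theta> + u \<in> \<Theta>"
  shows "(\<integral>\<^sup>+x. ennreal (exp (u * x + c)) \<partial>p \<theta>) = ennreal (exp (b (\<theta> + u) - b \<theta> + c))"
proof -
  have "1 = emeasure (p (\<theta> + u)) UNIV"
    using prob_space.emeasure_space_1[OF prob_space_p[OF assms]] by simp
  also have "\<dots> = (\<integral>\<^sup>+x. ennreal (exp (u * x - (b (\<theta> + u) - b \<theta>))) \<partial>p \<theta>)"
    unfolding density_p by (subst emeasure_density) auto
  finally have one: "(\<integral>\<^sup>+x. ennreal (exp (u * x - (b (\<theta> + u) - b \<theta>))) \<partial>p \<theta>) = 1" ..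
  have "(\<integral>\<^sup>+x. ennreal (exp (u * x + c)) \<partial>p \<theta>) =
      (\<integral>\<^sup>+x. ennreal (exp (b (\<theta> + u) - b \<theta> + c)) *
        ennreal (exp (u * x - (b (\<theta> + u) - b \<theta>))) \<partial>p \<theta>)"
    by (intro nn_integral_cong) (simp flip: ennreal_mult exp_add)
  then show ?thesis by (simp add: nn_integral_cmult one)
qed

lemma has_bochner_integral_exp_p:
  assumes "\<theta> + u \<in> \<Theta>"
  shows "has_bochner_integral (p \<theta>) (\<lambda>x. exp (u * x + c)) (exp (b (\<theta> + u) - b \<theta> + c))"
  by (rule has_bochner_integral_nn_integral) (auto simp: nn_integral_exp_p[OF assms])

lemma integrable_id_p:
  assumes "\<theta> \<in> \<Theta>"
  shows "integrable (p \<theta>) (\<lambda>x. x)"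
proof (rule integrableI_bounded)
  have "(\<integral>\<^sup>+x. ennreal (norm x) \<partial>p \<theta>) =
      (\<integral>\<^sup>+x. ennreal (exp (- b \<theta>)) * ennreal (\<bar>x\<bar> * exp (\<theta> * x)) \<partial>\<xi>)"
    unfolding exp_family_dist_def
    by (subst nn_integral_density)
       (auto intro!: nn_integral_cong simp: exp_diff exp_minus field_simps simp flip: ennreal_mult)
  also have "\<dots> = ennreal (exp (- b \<theta>)) * (\<integral>\<^sup>+x. ennreal (\<bar>x\<bar> * exp (\<theta> * x)) \<partial>\<xi>)"
    by (rule nn_integral_cmult) simp
  also have "\<dots> < \<infinity>"
    using assms by (simp add: natural_param_space_def ennreal_mult_less_top)
  finally show "(\<integral>\<^sup>+x. ennreal (norm x) \<partial>p \<theta>) < \<infinity>" .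
qed simp

text \<open>
  From \<open>exp (u x) \<ge> 1 + u x\<close>, the function
  \<open>u \<mapsto> exp (b (\<theta> + u) - b \<theta>) - u * mean\<close> has a local minimum at
  \<open>u = 0\<close>. Its derivative there, \<open>b' \<theta> - mean\<close>, must therefore vanish.
\<close>

lemma mean_p:
  assumes "\<theta> \<in> \<Theta>"
  shows "mean (p \<theta>) = deriv b \<theta>"
proof -
  interpret prob_space "p \<theta>" by (rule prob_space_p[OF assms])
  define f where "f = (\<lambda>u. exp (b (\<theta> + u) - b \<theta>) - u * mean (p \<theta>))"
  have "\<forall>\<^sub>F u in nhds 0. f 0 \<le> f u"
    using eventually_param[OF assms filterlim_ident]
  proof eventually_elim
    case (elim u)
    note u = this
    note I = has_bochner_integral_exp_p[OF u, of 0, simplified]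
    have "(\<integral>x. 1 + u * x \<partial>p \<theta>) \<le> (\<integral>x. exp (u * x) \<partial>p \<theta>)"
      using integrable_id_p[OF assms] I
      by (intro integral_mono) (auto simp: has_bochner_integral_iff exp_ge_add_one_self)
    then show ?case
      using integrable_id_p[OF assms] I
      by (simp add: f_def mean_def has_bochner_integral_iff prob_space[unfolded space_p])
  qed
  then obtain d where "d > 0" "\<And>u. \<bar>0 - u\<bar> < d \<Longrightarrow> f 0 \<le> f u"
    unfolding eventually_nhds_metric by (auto simp: dist_real_def)
  moreover have "(f has_real_derivative (deriv b \<theta> - mean (p \<theta>))) (at 0)"
    unfolding f_def using assms
    by (auto intro!: derivative_eq_intros DERIV_b_shift[of \<theta> 0, simplified])
  ultimately have "deriv b \<theta> - mean (p \<theta>) = 0" by (blast intro: DERIV_local_min)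
  then show ?thesis by simp
qed

lemma bregman_quadratic:
  assumes "\<theta> \<in> \<Theta>"
  shows "((\<lambda>u. bregman b \<theta> u / u\<^sup>2) \<longlongrightarrow> deriv (deriv b) \<theta> / 2) (at 0)"
proof (rule lhopital[where f' = "\<lambda>u. deriv b (\<theta> + u) - deriv b \<theta>" and g' = "\<lambda>u. 2 * u"])
  have D: "\<forall>\<^sub>F u in at 0. \<theta> + u \<in> \<Theta>" by (rule eventually_param[OF assms tendsto_ident_at])
  show "\<forall>\<^sub>F u in at 0. (bregman b \<theta> has_real_derivative (deriv b (\<theta> + u) - deriv b \<theta>)) (at u)"
    using D by (rule eventually_mono) (rule DERIV_bregman)
  have "isCont (bregman b \<theta>) 0"
    using DERIV_bregman[of \<theta> 0] assms by (auto intro: DERIV_isCont)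
  then show "(bregman b \<theta> \<longlongrightarrow> 0) (at 0)" by (simp add: isCont_def bregman_def)
  show "((\<lambda>u. u\<^sup>2) \<longlongrightarrow> 0) (at (0::real))" by (auto intro!: tendsto_eq_intros)
  show "\<forall>\<^sub>F u in at (0::real). u\<^sup>2 \<noteq> 0" "\<forall>\<^sub>F u in at (0::real). 2 * u \<noteq> 0"
    by (auto simp: eventually_at_filter)
  show "\<forall>\<^sub>F u in at 0. ((\<lambda>u. u\<^sup>2) has_real_derivative 2 * u) (at u)"
    by (auto intro!: always_eventually derivative_eq_intros)
  have "((\<lambda>u. (deriv b (\<theta> + u) - deriv b \<theta>) / u / 2) \<longlongrightarrow> deriv (deriv b) \<theta> / 2) (at 0)"
    using DERIV_deriv_b[OF assms] by (intro tendsto_divide) (auto simp: DERIV_def)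
  then show "((\<lambda>u. (deriv b (\<theta> + u) - deriv b \<theta>) / (2 * u)) \<longlongrightarrow> deriv (deriv b) \<theta> / 2) (at 0)"
    by (simp add: mult.commute)
qed

lemma bregman_nonneg:
  assumes "\<theta> \<in> \<Theta>" "\<theta> + u \<in> \<Theta>"
  shows "0 \<le> bregman b \<theta> u"
proof -
  interpret prob_space "p \<theta>" by (rule prob_space_p[OF assms(1)])
  note I = has_bochner_integral_exp_p[OF assms(2), of "- u * mean (p \<theta>)"]
  have "(\<integral>x. 1 + (u * x + - u * mean (p \<theta>)) \<partial>p \<theta>) \<le> (\<integral>x. exp (u * x + - u * mean (p \<theta>)) \<partial>p \<theta>)"
    using integrable_id_p[OF assms(1)] I
    by (intro integral_mono) (auto simp: has_bochner_integral_iff exp_ge_add_one_self)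
  also have "(\<integral>x. 1 + (u * x + - u * mean (p \<theta>)) \<partial>p \<theta>) = 1"
    using integrable_id_p[OF assms(1)] by (simp add: mean_def prob_space[unfolded space_p])
  also have "(\<integral>x. exp (u * x + - u * mean (p \<theta>)) \<partial>p \<theta>) = exp (bregman b \<theta> u)"
    using I by (simp add: has_bochner_integral_iff bregman_def mean_p[OF assms(1)])
  finally show ?thesis by simp
qed

text \<open>
  Integrating \<open>(u y)\<^sup>2 \<le> exp (u y) + exp (- u y) - 2\<close> over the centred variable
  \<open>y\<close> gives \<open>u\<^sup>2 * variance \<le> exp (D u) + exp (D (- u)) - 2\<close> with
  \<open>D = bregman b \<theta>\<close>. Dividing by \<open>u\<^sup>2\<close> and letting \<open>u\<close> tend to 0 turns the right
  side into the second derivative. Equality holds in fact, but the lower bound on the width needs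
  only this direction.
\<close>

lemma variance_p_le:
  assumes "\<theta> \<in> \<Theta>"
  shows "(\<integral>x. (x - mean (p \<theta>))\<^sup>2 \<partial>p \<theta>) \<le> deriv (deriv b) \<theta>"
proof -
  interpret prob_space "p \<theta>" by (rule prob_space_p[OF assms])
  let ?V = "\<integral>x. (x - mean (p \<theta>))\<^sup>2 \<partial>p \<theta>"
  let ?v = "deriv (deriv b) \<theta>"
  let ?D = "bregman b \<theta>"
  note q = bregman_quadratic[OF assms]
  have neg: "filterlim uminus (at 0) (at (0::real))"
    unfolding filterlim_at by (auto simp: eventually_at_filter intro!: tendsto_eq_intros)
  have q': "((\<lambda>u. ?D (- u) / u\<^sup>2) \<longlongrightarrow> ?v / 2) (at 0)"
    using filterlim_compose[OF q neg] by simp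
  have mgf: "has_bochner_integral (p \<theta>) (\<lambda>x. exp (u * (x - mean (p \<theta>)))) (exp (?D u))"
    if "\<theta> + u \<in> \<Theta>" for u
    using has_bochner_integral_exp_p[OF that, of "- u * mean (p \<theta>)"]
    by (simp add: bregman_def mean_p[OF assms] algebra_simps)
  have "isCont ?D 0"
    using DERIV_bregman[of \<theta> 0] assms by (auto intro: DERIV_isCont)
  then have D0: "(?D \<longlongrightarrow> 0) (at 0)" by (simp add: isCont_def bregman_def)
  have D0': "((\<lambda>u. ?D (- u)) \<longlongrightarrow> 0) (at 0)"
    by (rule filterlim_compose[OF D0 neg])
  have "?V \<le> ?v / 2 * (1 + 0) + ?v / 2 * (1 + 0)"
  proof (rule tendsto_lowerbound)
    show "((\<lambda>u. ?D u / u\<^sup>2 * (1 + ?D u) + ?D (- u) / u\<^sup>2 * (1 + ?D (- u))) \<longlongrightarrow>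
        ?v / 2 * (1 + 0) + ?v / 2 * (1 + 0)) (at 0)"
      by (intro tendsto_intros q q' D0 D0')
    have "((\<lambda>u::real. - u) \<longlongrightarrow> 0) (at 0)" by (auto intro!: tendsto_eq_intros)
    note small = eventually_param[OF assms tendsto_ident_at] eventually_param[OF assms this]
      order_tendstoD(2)[OF D0 zero_less_one] order_tendstoD(2)[OF D0' zero_less_one]
    show "\<forall>\<^sub>F u in at 0. ?V \<le> ?D u / u\<^sup>2 * (1 + ?D u) + ?D (- u) / u\<^sup>2 * (1 + ?D (- u))"
      using small eventually_neq_at_within[of 0]
    proof eventually_elim
      case (elim u)
      let ?g = "\<lambda>x. exp (u * (x - mean (p \<theta>))) + exp (- u * (x - mean (p \<theta>))) - 2"
      have g: "has_bochner_integral (p \<theta>) ?g (exp (?D u) + exp (?D (- u)) - 2)"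
        using mgf[of u] mgf[of "- u"] elim
        by (intro has_bochner_integral_add has_bochner_integral_diff)
           (auto simp: has_bochner_integral_iff prob_space[unfolded space_p])
      have pt: "u\<^sup>2 * (x - mean (p \<theta>))\<^sup>2 \<le> ?g x" for x
        using square_le_exp_sum[of "u * (x - mean (p \<theta>))"] by (simp add: power_mult_distrib)
      have int: "integrable (p \<theta>) (\<lambda>x. u\<^sup>2 * (x - mean (p \<theta>))\<^sup>2)"
      proof (rule Bochner_Integration.integrable_bound)
        show "integrable (p \<theta>) ?g" using g by (simp only: has_bochner_integral_iff)
        show "AE x in p \<theta>. norm (u\<^sup>2 * (x - mean (p \<theta>))\<^sup>2) \<le> norm (?g x)"
        proof (rule AE_I2)
          fix x
          have "norm (u\<^sup>2 * (x - mean (p \<theta>))\<^sup>2) = u\<^sup>2 * (x - mean (p \<theta>))\<^sup>2" by simp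
          also note pt[of x]
          also have "?g x \<le> norm (?g x)" unfolding real_norm_def by (rule abs_ge_self)
          finally show "norm (u\<^sup>2 * (x - mean (p \<theta>))\<^sup>2) \<le> norm (?g x)" .
        qed
      qed measurable
      have "u\<^sup>2 * ?V = (\<integral>x. u\<^sup>2 * (x - mean (p \<theta>))\<^sup>2 \<partial>p \<theta>)" by simp
      also have "\<dots> \<le> (\<integral>x. ?g x \<partial>p \<theta>)"
        using g pt by (intro integral_mono int) (simp_all only: has_bochner_integral_iff)
      also have "\<dots> = exp (?D u) + exp (?D (- u)) - 2"
        using g by (simp only: has_bochner_integral_iff)
      also have "\<dots> \<le> ?D u * (1 + ?D u) + ?D (- u) * (1 + ?D (- u))"
        using exp_bound[of "?D u"] exp_bound[of "?D (- u)"] elim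
          bregman_nonneg[OF assms, of u] bregman_nonneg[OF assms, of "- u"]
        by (simp add: power2_eq_square algebra_simps)
      finally have "?V * u\<^sup>2 \<le> ?D u * (1 + ?D u) + ?D (- u) * (1 + ?D (- u))"
        by (simp add: mult.commute)
      then have "?V \<le> (?D u * (1 + ?D u) + ?D (- u) * (1 + ?D (- u))) / u\<^sup>2"
        using elim by (simp add: pos_le_divide_eq)
      then show ?case by (simp add: add_divide_distrib)
    qed
  qed simp
  then show ?thesis by simp
qed

section \<open>Testing between two members of the family\<close>

text \<open>
  This is the change of measure for \<open>n\<close> observations, where the power moment of the likelihood
  ratio factorises. Tilting \<open>\<theta>\<close> by \<open>- \<kappa> h\<close> evaluates each factor. The linear
  terms in \<open>b' \<theta>\<close> cancel, which leaves only Bregman divergences, of second order in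
  \<open>h\<close>.
\<close>

lemma error_tradeoff:
  assumes \<theta>: "\<theta> \<in> \<Theta>" "\<theta> + h \<in> \<Theta>" "\<theta> + - \<kappa> * h \<in> \<Theta>" and \<kappa>: "0 \<le> \<kappa>"
    and A: "A \<in> sets (PiM {1..n} (\<lambda>_. borel))"
  shows "measure (PiM {1..n} (\<lambda>_. p \<theta>)) A \<le>
    exp K * measure (PiM {1..n} (\<lambda>_. p (\<theta> + h))) A +
    exp (real n * (\<kappa> * bregman b \<theta> h + bregman b \<theta> (- \<kappa> * h)) - \<kappa> * K)"
proof -
  let ?P = "PiM {1..n} (\<lambda>_::nat. p \<theta>)" and ?P' = "PiM {1..n} (\<lambda>_::nat. p (\<theta> + h))"
  define \<Delta> where "\<Delta> = b (\<theta> + h) - b \<theta>"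
  define g where "g = (\<lambda>X::nat \<Rightarrow> real. \<Sum>i\<in>{1..n}. \<Delta> - h * X i)"
  interpret P: product_prob_space "\<lambda>_::nat. p \<theta>"
    by (rule product_prob_space_const[OF prob_space_p[OF \<theta>(1)]])
  interpret P: prob_space ?P by (rule prob_space_PiM[OF prob_space_p[OF \<theta>(1)]])
  interpret P': prob_space ?P' by (rule prob_space_PiM[OF prob_space_p[OF \<theta>(2)]])
  have sets_P: "sets ?P = sets (PiM {1..n} (\<lambda>_. borel))" by (intro sets_PiM_cong) auto
  have g [measurable]: "g \<in> borel_measurable ?P" unfolding g_def by measurable
  have dens: "?P' = density ?P (\<lambda>X. ennreal (exp (- g X)))"
  proof -
    have "?P' = density ?P (\<lambda>X. \<Prod>i\<in>{1..n}. ennreal (exp (h * X i - \<Delta>)))"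
      unfolding density_p \<Delta>_def using prob_space_p[OF \<theta>(1)] prob_space_p[OF \<theta>(2)]
      by (intro PiM_density) (auto simp flip: density_p)
    also have "(\<lambda>X. \<Prod>i\<in>{1..n}. ennreal (exp (h * X i - \<Delta>))) = (\<lambda>X. ennreal (exp (- g X)))"
      by (simp add: prod_ennreal g_def flip: exp_sum sum_negf)
    finally show ?thesis .
  qed
  have "(\<integral>\<^sup>+X. ennreal (exp (\<kappa> * (g X - K))) \<partial>?P) =
      (\<integral>\<^sup>+X. ennreal (exp (- (\<kappa> * K))) * (\<Prod>i\<in>{1..n}. ennreal (exp (- \<kappa> * h * X i + \<kappa> * \<Delta>))) \<partial>?P)"
    by (intro nn_integral_cong)
       (simp add: prod_ennreal g_def sum_distrib_left algebra_simps
         flip: exp_sum ennreal_mult exp_add)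
  also have "\<dots> = ennreal (exp (- (\<kappa> * K))) * (\<Prod>i\<in>{1..n}. ennreal (exp (b (\<theta> + - \<kappa> * h) - b \<theta> + \<kappa> * \<Delta>)))"
  proof (subst nn_integral_cmult)
    show "(\<lambda>X. \<Prod>i\<in>{1..n}. ennreal (exp (- \<kappa> * h * X i + \<kappa> * \<Delta>))) \<in> borel_measurable ?P"
      by measurable
    show "ennreal (exp (- (\<kappa> * K))) * (\<integral>\<^sup>+X. (\<Prod>i\<in>{1..n}. ennreal (exp (- \<kappa> * h * X i + \<kappa> * \<Delta>))) \<partial>?P) =
        ennreal (exp (- (\<kappa> * K))) * (\<Prod>i\<in>{1..n}. ennreal (exp (b (\<theta> + - \<kappa> * h) - b \<theta> + \<kappa> * \<Delta>)))"
      by (subst P.product_nn_integral_prod) (auto simp: nn_integral_exp_p[OF \<theta>(3), simplified])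
  qed
  also have "\<dots> = ennreal (exp (real n * (\<kappa> * bregman b \<theta> h + bregman b \<theta> (- \<kappa> * h)) - \<kappa> * K))"
    by (simp add: ennreal_power bregman_def \<Delta>_def algebra_simps
        flip: exp_of_nat_mult ennreal_mult exp_add)
  finally have mom: "(\<integral>\<^sup>+X. ennreal (exp (\<kappa> * (g X - K))) \<partial>?P) = \<dots>" .
  have "emeasure ?P A \<le> ennreal (exp K) * emeasure ?P' A + (\<integral>\<^sup>+X. ennreal (exp (\<kappa> * (g X - K))) \<partial>?P)"
    unfolding dens using A \<kappa> g unfolding sets_P[symmetric]
    by (intro emeasure_le_change_of_measure)
  then show ?thesis
    unfolding mom P.emeasure_eq_measure P'.emeasure_eq_measure
    by (simp flip: ennreal_mult ennreal_plus)
qed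

lemma bregman_scaling:
  assumes "\<theta> \<in> \<Theta>" and r: "(r \<longlongrightarrow> 0) F" "\<forall>\<^sub>F i in F. r i \<noteq> 0"
  shows "((\<lambda>i. bregman b \<theta> (s * r i) / (r i)\<^sup>2) \<longlongrightarrow> s\<^sup>2 * (deriv (deriv b) \<theta> / 2)) F"
proof (cases "s = 0")
  case False
  then have "filterlim (\<lambda>i. s * r i) (at 0) F"
    using r tendsto_mult_right_zero[OF r(1), of s] by (auto simp: filterlim_at)
  from tendsto_mult[OF tendsto_const filterlim_compose[OF bregman_quadratic[OF assms(1)] this], of "s\<^sup>2"]
  show ?thesis using False by (simp add: power_mult_distrib)
qed (simp add: bregman_def)

lemma mean_scaling:
  assumes "\<theta> \<in> \<Theta>" and r: "(r \<longlongrightarrow> 0) F" "\<forall>\<^sub>F i in F. r i \<noteq> 0"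
  shows "((\<lambda>i. (deriv b (\<theta> + t * r i) - deriv b \<theta>) / r i) \<longlongrightarrow> t * deriv (deriv b) \<theta>) F"
proof (cases "t = 0")
  case False
  then have "filterlim (\<lambda>i. t * r i) (at 0) F"
    using r tendsto_mult_right_zero[OF r(1), of t] by (auto simp: filterlim_at)
  from tendsto_mult[OF tendsto_const filterlim_compose[OF DERIV_deriv_b[OF assms(1), unfolded DERIV_def] this], of t]
  show ?thesis using False by simp
qed simp

section \<open>Alternatives at the rate of the interval width\<close>

context
  fixes N :: "real \<Rightarrow> nat"
  assumes N: "filterlim (\<lambda>\<delta>. real (N \<delta>) / ln (1 / \<delta>)) at_top (at_right 0)"
begin

lemma eventually_rate:
  "\<forall>\<^sub>F \<delta> in at_right 0. 0 < \<delta> \<and> \<delta> < 1 \<and> 0 < ci_rate N \<delta> \<and>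
     real (N \<delta>) * (ci_rate N \<delta>)\<^sup>2 = ln (1 / \<delta>)"
proof -
  have "\<forall>\<^sub>F \<delta> in at_right 0. \<delta> \<in> {0<..<1::real}" by (intro eventually_at_right_real) simp
  moreover have "\<forall>\<^sub>F \<delta> in at_right 0. 0 < real (N \<delta>) / ln (1 / \<delta>)"
    using N by (simp add: filterlim_at_top_dense)
  ultimately show ?thesis
  proof eventually_elim
    case (elim \<delta>)
    then have "0 < ln (1 / \<delta>)" by (intro ln_gt_zero) auto
    with elim show ?case by (auto simp: ci_rate_def zero_less_divide_iff)
  qed
qed

lemma rate_tendsto_0: "(ci_rate N \<longlongrightarrow> 0) (at_right 0)"
proof -
  have "((\<lambda>\<delta>. sqrt (inverse (real (N \<delta>) / ln (1 / \<delta>)))) \<longlongrightarrow> sqrt 0) (at_right 0)"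
    by (intro tendsto_real_sqrt tendsto_inverse_0_at_top N)
  then show ?thesis by (simp add: ci_rate_def[abs_def])
qed

lemma eventually_rate_nonzero: "\<forall>\<^sub>F \<delta> in at_right 0. ci_rate N \<delta> \<noteq> 0"
  using eventually_rate by eventually_elim auto

text \<open>
  The threshold in \<open>error_tradeoff\<close> is \<open>K = (1 - \<epsilon>) * ln (1 / \<delta>)\<close>, so the
  error \<open>\<delta>\<close> under the alternative contributes at most \<open>\<delta> powr \<epsilon>\<close>. At
  the scale \<open>h = t * ci_rate N \<delta>\<close> the second exponent is \<open>ln (1 / \<delta>)\<close> times a
  factor converging to \<open>\<kappa> * (a + \<kappa> * a - (1 - \<epsilon>))\<close> with
  \<open>a = t\<^sup>2 * b'' \<theta> / 2 < 1\<close>. This limit is negative once \<open>\<epsilon>\<close> and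
  \<open>\<kappa>\<close> are small compared with \<open>1 - a\<close>.
\<close>

lemma undetectable_alternative:
  assumes \<theta>: "\<theta> \<in> \<Theta>" and t: "t\<^sup>2 * (deriv (deriv b) \<theta> / 2) < 1"
    and A: "\<forall>\<^sub>F \<delta> in at_right 0. A \<delta> \<in> sets (PiM {1..N \<delta>} (\<lambda>_. borel))"
    and small: "\<forall>\<^sub>F \<delta> in at_right 0. \<theta> + t * ci_rate N \<delta> \<in> \<Theta> \<longrightarrow>
      measure (PiM {1..N \<delta>} (\<lambda>_. p (\<theta> + t * ci_rate N \<delta>))) (A \<delta>) \<le> \<delta>"
  shows "((\<lambda>\<delta>. measure (PiM {1..N \<delta>} (\<lambda>_. p \<theta>)) (A \<delta>)) \<longlongrightarrow> 0) (at_right 0)"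
proof -
  let ?v = "deriv (deriv b) \<theta>" and ?r = "ci_rate N"
  let ?L = "\<lambda>\<delta>. ln (1 / \<delta>) :: real"
  define a where "a = t\<^sup>2 * (?v / 2)"
  \<comment> \<open>A single small number serves both as the slack in the threshold and as the moment order.\<close>
  define \<epsilon> where "\<epsilon> = (1 - a) / 4"
  have "a < 1" using t by (simp add: a_def)
  then have \<epsilon>: "0 < \<epsilon>" "a = 1 - 4 * \<epsilon>" by (auto simp: \<epsilon>_def field_simps)
  define c where "c = (\<lambda>\<delta>. \<epsilon> * (bregman b \<theta> (t * ?r \<delta>) / (?r \<delta>)\<^sup>2) +
      bregman b \<theta> (- \<epsilon> * t * ?r \<delta>) / (?r \<delta>)\<^sup>2 - \<epsilon> * (1 - \<epsilon>))"
  have L: "filterlim ?L at_top (at_right 0)" by real_asymp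
  have "(c \<longlongrightarrow> \<epsilon> * (t\<^sup>2 * (?v / 2)) + (- \<epsilon> * t)\<^sup>2 * (?v / 2) - \<epsilon> * (1 - \<epsilon>)) (at_right 0)"
    unfolding c_def
    by (intro tendsto_intros bregman_scaling[OF \<theta> rate_tendsto_0 eventually_rate_nonzero])
  also have "\<epsilon> * (t\<^sup>2 * (?v / 2)) + (- \<epsilon> * t)\<^sup>2 * (?v / 2) - \<epsilon> * (1 - \<epsilon>) =
      \<epsilon> * (a + \<epsilon> * a - (1 - \<epsilon>))"
    by (simp add: a_def algebra_simps power2_eq_square)
  also have "\<dots> = - (\<epsilon>\<^sup>2 * (2 + 4 * \<epsilon>))"
    by (simp add: \<epsilon>(2) algebra_simps power2_eq_square)
  finally have c: "(c \<longlongrightarrow> - (\<epsilon>\<^sup>2 * (2 + 4 * \<epsilon>))) (at_right 0)" .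
  have neg: "- (\<epsilon>\<^sup>2 * (2 + 4 * \<epsilon>)) < 0" using \<epsilon>(1) by simp
  show ?thesis
  proof (rule tendsto_sandwich[OF _ _ tendsto_const])
    have "((\<lambda>\<delta>. exp (- \<epsilon> * ?L \<delta>)) \<longlongrightarrow> 0) (at_right 0)"
      using \<epsilon>(1) by (intro filterlim_compose[OF exp_at_bot] filterlim_tendsto_neg_mult_at_bot[OF tendsto_const _ L]) simp
    moreover have "((\<lambda>\<delta>. exp (c \<delta> * ?L \<delta>)) \<longlongrightarrow> 0) (at_right 0)"
      by (intro filterlim_compose[OF exp_at_bot] filterlim_tendsto_neg_mult_at_bot[OF c neg L])
    ultimately show "((\<lambda>\<delta>. exp (- \<epsilon> * ?L \<delta>) + exp (c \<delta> * ?L \<delta>)) \<longlongrightarrow> 0) (at_right 0)"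
      by (rule tendsto_add_zero)
    note in\<Theta> = eventually_param[OF \<theta> tendsto_mult_right_zero[OF rate_tendsto_0]]
    show "\<forall>\<^sub>F \<delta> in at_right 0. measure (PiM {1..N \<delta>} (\<lambda>_. p \<theta>)) (A \<delta>) \<le>
        exp (- \<epsilon> * ?L \<delta>) + exp (c \<delta> * ?L \<delta>)"
      using A small eventually_rate in\<Theta>[of t] in\<Theta>[of "- \<epsilon> * t"]
    proof eventually_elim
      case (elim \<delta>)
      let ?h = "t * ?r \<delta>"
      let ?K = "(1 - \<epsilon>) * ?L \<delta>"
      have "measure (PiM {1..N \<delta>} (\<lambda>_. p \<theta>)) (A \<delta>) \<le>
          exp ?K * measure (PiM {1..N \<delta>} (\<lambda>_. p (\<theta> + ?h))) (A \<delta>) +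
          exp (real (N \<delta>) * (\<epsilon> * bregman b \<theta> ?h + bregman b \<theta> (- \<epsilon> * ?h)) - \<epsilon> * ?K)"
        using elim \<epsilon>(1) by (intro error_tradeoff[OF \<theta>]) (auto simp: mult.assoc)
      also have "exp ?K * measure (PiM {1..N \<delta>} (\<lambda>_. p (\<theta> + ?h))) (A \<delta>) \<le> exp ?K * \<delta>"
        using elim by (intro mult_left_mono) auto
      also have "exp ?K * \<delta> = exp (- \<epsilon> * ?L \<delta>)"
      proof -
        have "\<delta> = exp (- ?L \<delta>)" using elim by (simp add: ln_div)
        then have "exp ?K * \<delta> = exp ?K * exp (- ?L \<delta>)" by simp
        then show ?thesis by (simp add: algebra_simps flip: exp_add)
      qed
      also have "real (N \<delta>) * (\<epsilon> * bregman b \<theta> ?h + bregman b \<theta> (- \<epsilon> * ?h)) - \<epsilon> * ?K = c \<delta> * ?L \<delta>"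
      proof -
        have "?r \<delta> \<noteq> 0" and L: "?L \<delta> = real (N \<delta>) * (?r \<delta>)\<^sup>2" using elim by auto
        then have scale: "x / (?r \<delta>)\<^sup>2 * ?L \<delta> = real (N \<delta>) * x" for x by simp
        have "c \<delta> * ?L \<delta> = \<epsilon> * (bregman b \<theta> ?h / (?r \<delta>)\<^sup>2 * ?L \<delta>) +
            bregman b \<theta> (- \<epsilon> * ?h) / (?r \<delta>)\<^sup>2 * ?L \<delta> - \<epsilon> * ?K"
          unfolding c_def by (simp only: ring_distribs mult.assoc)
        also have "\<dots> = \<epsilon> * (real (N \<delta>) * bregman b \<theta> ?h) + real (N \<delta>) * bregman b \<theta> (- \<epsilon> * ?h) - \<epsilon> * ?K"
          by (simp only: scale)
        finally show ?thesis by (simp add: algebra_simps)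
      qed
      finally show ?case by simp
    qed
  qed (auto intro: always_eventually)
qed

section \<open>Lower bounds for the normalised endpoints\<close>

context
  fixes \<pi> :: policy and \<theta> :: real
  assumes \<pi>: "\<pi> \<in> CI_policies \<xi> b" and size: "sample_size_fun N" and \<theta>: "\<theta> \<in> \<Theta>"
begin

abbreviation (input) P where "P \<equiv> iid_seq (p \<theta>)"

lemma endpoints_measurable_finite:
  assumes "n \<ge> 1" "0 < \<delta>" "\<delta> < 1"
  shows "lower \<pi> n \<delta> \<in> borel_measurable (PiM {1..n} (\<lambda>_. borel))"
    "upper \<pi> n \<delta> \<in> borel_measurable (PiM {1..n} (\<lambda>_. borel))"
  using \<pi> assms by (auto simp: CI_policies_def measurable_policy_def)

lemma eventually_endpoints_measurable:
  "\<forall>\<^sub>F \<delta> in at_right 0. mu_L \<pi> (N \<delta>) \<delta> \<in> borel_measurable P \<and> mu_R \<pi> (N \<delta>) \<delta> \<in> borel_measurable P"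
  using eventually_rate
proof eventually_elim
  case (elim \<delta>)
  then have "N \<delta> \<ge> 1" using size by (auto simp: sample_size_fun_def)
  then show ?case
    unfolding mu_L_def[abs_def] mu_R_def[abs_def] using elim
    by (intro conjI measurable_compose[OF measurable_restrict_iid_seq endpoints_measurable_finite(1)]
        measurable_compose[OF measurable_restrict_iid_seq endpoints_measurable_finite(2)] sets_p)
      simp_all
qed

text \<open>
  Coverage at the alternative bounds the probability of missing its mean by \<open>\<delta>\<close> there,
  and \<open>undetectable_alternative\<close> carries this over to \<open>\<theta>\<close>.
\<close>

lemma exclusion_vanishes:
  assumes t: "t\<^sup>2 * (deriv (deriv b) \<theta> / 2) < 1"
  shows "((\<lambda>\<delta>. measure P {X \<in> space P. ereal (deriv b (\<theta> + t * ci_rate N \<delta>)) \<notin>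
    {mu_L \<pi> (N \<delta>) \<delta> X .. mu_R \<pi> (N \<delta>) \<delta> X}}) \<longlongrightarrow> 0) (at_right 0)"
proof -
  define m where "m = (\<lambda>\<delta>. ereal (deriv b (\<theta> + t * ci_rate N \<delta>)))"
  define A where "A = (\<lambda>\<delta>. {Y \<in> space (PiM {1..N \<delta>} (\<lambda>_. borel)).
      m \<delta> \<notin> {lower \<pi> (N \<delta>) \<delta> Y .. upper \<pi> (N \<delta>) \<delta> Y}})"
  have pos: "\<forall>\<^sub>F \<delta> in at_right 0. 0 < \<delta> \<and> \<delta> < 1 \<and> 1 \<le> N \<delta>"
    using eventually_rate size by (auto simp: sample_size_fun_def elim!: eventually_mono)
  have A: "\<forall>\<^sub>F \<delta> in at_right 0. A \<delta> \<in> sets (PiM {1..N \<delta>} (\<lambda>_. borel))"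
    using pos
  proof eventually_elim
    case (elim \<delta>)
    then have [measurable]: "lower \<pi> (N \<delta>) \<delta> \<in> borel_measurable (PiM {1..N \<delta>} (\<lambda>_. borel))"
      "upper \<pi> (N \<delta>) \<delta> \<in> borel_measurable (PiM {1..N \<delta>} (\<lambda>_. borel))"
      by (simp_all only: endpoints_measurable_finite)
    show ?case unfolding A_def atLeastAtMost_iff by measurable
  qed
  have sets_eq: "sets (PiM {1..n} (\<lambda>_. p \<theta>')) = sets (PiM {1..n} (\<lambda>_. borel))" for n :: nat and \<theta>'
    by (intro sets_PiM_cong) auto
  have event: "{X \<in> space (iid_seq (p \<theta>')). restrict X {1..N \<delta>} \<in> A \<delta>} =
      {X \<in> space (iid_seq (p \<theta>')). m \<delta> \<notin> {mu_L \<pi> (N \<delta>) \<delta> X .. mu_R \<pi> (N \<delta>) \<delta> X}}" for \<theta>' \<delta>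
    by (auto simp: A_def mu_L_def mu_R_def space_PiM)
  have transfer: "measure (PiM {1..N \<delta>} (\<lambda>_. p \<theta>')) (A \<delta>) =
      measure (iid_seq (p \<theta>')) {X \<in> space (iid_seq (p \<theta>')). m \<delta> \<notin> {mu_L \<pi> (N \<delta>) \<delta> X .. mu_R \<pi> (N \<delta>) \<delta> X}}"
    if "A \<delta> \<in> sets (PiM {1..N \<delta>} (\<lambda>_. borel))" "\<theta>' \<in> \<Theta>" for \<theta>' \<delta>
    using measure_iid_seq[OF prob_space_p[OF that(2)], of "A \<delta>" "N \<delta>"] that(1)
    by (simp only: sets_eq event)
  have "((\<lambda>\<delta>. measure (PiM {1..N \<delta>} (\<lambda>_. p \<theta>)) (A \<delta>)) \<longlongrightarrow> 0) (at_right 0)"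
  proof (rule undetectable_alternative[OF \<theta> t A])
    show "\<forall>\<^sub>F \<delta> in at_right 0. \<theta> + t * ci_rate N \<delta> \<in> \<Theta> \<longrightarrow>
        measure (PiM {1..N \<delta>} (\<lambda>_. p (\<theta> + t * ci_rate N \<delta>))) (A \<delta>) \<le> \<delta>"
      using A pos
    proof eventually_elim
      case (elim \<delta>)
      show ?case
      proof
        let ?\<theta>' = "\<theta> + t * ci_rate N \<delta>"
        assume \<theta>': "?\<theta>' \<in> \<Theta>"
        interpret I: prob_space "iid_seq (p ?\<theta>')"
          by (rule prob_space_iid_seq[OF prob_space_p[OF \<theta>']])
        let ?cov = "{X \<in> space (iid_seq (p ?\<theta>')). m \<delta> \<in> {mu_L \<pi> (N \<delta>) \<delta> X .. mu_R \<pi> (N \<delta>) \<delta> X}}"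
        have "p ?\<theta>' \<in> exp_family \<xi> b" using \<theta>' by (auto simp: exp_family_def)
        then have cov: "1 - \<delta> \<le> measure (iid_seq (p ?\<theta>')) ?cov"
          using \<pi> elim unfolding CI_policies_def m_def mean_p[OF \<theta>', symmetric] by auto
        have "?cov = space (iid_seq (p ?\<theta>')) - {X \<in> space (iid_seq (p ?\<theta>')). restrict X {1..N \<delta>} \<in> A \<delta>}"
          unfolding event by auto
        moreover have "{X \<in> space (iid_seq (p ?\<theta>')). restrict X {1..N \<delta>} \<in> A \<delta>} \<in> sets (iid_seq (p ?\<theta>'))"
          using measurable_sets[OF measurable_restrict_iid_seq[OF sets_p] elim(1), of ?\<theta>']
          by (simp add: vimage_def Int_def) (simp add: conj_commute)
        ultimately have "measure (iid_seq (p ?\<theta>')) ?cov =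
            1 - measure (PiM {1..N \<delta>} (\<lambda>_. p ?\<theta>')) (A \<delta>)"
          by (simp only: I.prob_compl transfer[OF elim(1) \<theta>'] event)
        with cov show "measure (PiM {1..N \<delta>} (\<lambda>_. p ?\<theta>')) (A \<delta>) \<le> \<delta>" by simp
      qed
    qed
  qed
  then show ?thesis
  proof (rule Lim_transform_eventually)
    show "\<forall>\<^sub>F \<delta> in at_right 0. measure (PiM {1..N \<delta>} (\<lambda>_. p \<theta>)) (A \<delta>) =
        measure P {X \<in> space P. ereal (deriv b (\<theta> + t * ci_rate N \<delta>)) \<notin>
          {mu_L \<pi> (N \<delta>) \<delta> X .. mu_R \<pi> (N \<delta>) \<delta> X}}"
      using A by eventually_elim (rule transfer[OF _ \<theta>, unfolded m_def])
  qed
qed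

text \<open>
  If the normalised endpoint \<open>Y\<close> settled near \<open>c\<close> while every value near \<open>c\<close> forced the
  interval to miss the mean of the alternative, then the whole space would be covered by two events
  of vanishing probability.
\<close>

lemma no_exclusion:
  assumes t: "t\<^sup>2 * (deriv (deriv b) \<theta> / 2) < 1"
    and Y: "tendsto_in_prob P Y c (at_right 0)" and U: "open U" "c \<in> U"
    and meas: "\<forall>\<^sub>F \<delta> in at_right 0. Y \<delta> \<in> borel_measurable P"
    and excl: "\<forall>\<^sub>F \<delta> in at_right 0. \<forall>X\<in>space P. Y \<delta> X \<in> U \<longrightarrow>
      ereal (deriv b (\<theta> + t * ci_rate N \<delta>)) \<notin> {mu_L \<pi> (N \<delta>) \<delta> X .. mu_R \<pi> (N \<delta>) \<delta> X}"
  shows False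
proof -
  interpret prob_space P by (rule prob_space_iid_seq[OF prob_space_p[OF \<theta>]])
  let ?m = "\<lambda>\<delta>. ereal (deriv b (\<theta> + t * ci_rate N \<delta>))"
  let ?E = "\<lambda>\<delta>. {X \<in> space P. ?m \<delta> \<notin> {mu_L \<pi> (N \<delta>) \<delta> X .. mu_R \<pi> (N \<delta>) \<delta> X}}"
  let ?B = "\<lambda>\<delta>. {X \<in> space P. Y \<delta> X \<notin> U}"
  have "((\<lambda>\<delta>. measure P (?B \<delta>) + measure P (?E \<delta>)) \<longlongrightarrow> 0 + 0) (at_right 0)"
    using Y U by (intro tendsto_add exclusion_vanishes[OF t]) (auto simp: tendsto_in_prob_def)
  then have "(1::real) \<le> 0 + 0"
  proof (rule tendsto_lowerbound)
    show "\<forall>\<^sub>F \<delta> in at_right 0. 1 \<le> measure P (?B \<delta>) + measure P (?E \<delta>)"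
      using meas excl eventually_endpoints_measurable
    proof eventually_elim
      case (elim \<delta>)
      have [measurable]: "U \<in> sets borel" using U by simp
      from elim have [measurable]: "Y \<delta> \<in> borel_measurable P"
        "mu_L \<pi> (N \<delta>) \<delta> \<in> borel_measurable P" "mu_R \<pi> (N \<delta>) \<delta> \<in> borel_measurable P" by auto
      have "space P = ?B \<delta> \<union> ?E \<delta>" using elim by blast
      then have "1 = measure P (?B \<delta> \<union> ?E \<delta>)" by (metis prob_space)
      also have "\<dots> \<le> measure P (?B \<delta>) + measure P (?E \<delta>)"
        unfolding atLeastAtMost_iff by (intro measure_Un_le) measurable
      finally show ?case .
    qed
  qed simp
  then show False by simp
qed

text \<open>
  If the limit \<open>q\<close> were smaller, a number \<open>s\<close> strictly between it and the bound would define an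
  alternative with tilt \<open>s / b'' \<theta>\<close> per unit of rate. To first order its mean lies \<open>s\<close> rate
  units above the mean at \<open>\<theta>\<close>, hence eventually above the upper endpoint, yet
  \<open>s\<^sup>2 < 2 * b'' \<theta>\<close> makes the alternative undetectable. When
  \<open>b'' \<theta> = 0\<close> the bound is 0 and there is nothing to prove.
\<close>

lemma upper_rate_ge:
  assumes "tendsto_in_prob P
      (\<lambda>\<delta> X. (mu_R \<pi> (N \<delta>) \<delta> X - ereal (deriv b \<theta>)) / ereal (ci_rate N \<delta>)) (ereal q) (at_right 0)"
    and q: "0 \<le> q"
  shows "sqrt (2 * deriv (deriv b) \<theta>) \<le> q"
proof (rule ccontr)
  let ?v = "deriv (deriv b) \<theta>"
  assume "\<not> sqrt (2 * ?v) \<le> q"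
  then obtain s where s: "q < s" "s < sqrt (2 * ?v)" using dense[of q] by force
  then have "0 < sqrt (2 * ?v)" using q by linarith
  then have v: "0 < ?v" by simp
  have "s\<^sup>2 < (sqrt (2 * ?v))\<^sup>2" using s q by (intro power_strict_mono) auto
  with v have t: "(s / ?v)\<^sup>2 * (?v / 2) < 1"
    by (simp add: power_divide power2_eq_square field_simps)
  obtain w where w: "q < w" "w < s" using dense[OF s(1)] by auto
  have "((\<lambda>\<delta>. (deriv b (\<theta> + s / ?v * ci_rate N \<delta>) - deriv b \<theta>) / ci_rate N \<delta>) \<longlongrightarrow> s / ?v * ?v) (at_right 0)"
    by (rule mean_scaling[OF \<theta> rate_tendsto_0 eventually_rate_nonzero])
  then have slope: "\<forall>\<^sub>F \<delta> in at_right 0. w < (deriv b (\<theta> + s / ?v * ci_rate N \<delta>) - deriv b \<theta>) / ci_rate N \<delta>"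
    using v w by (intro order_tendstoD) auto
  show False
  proof (rule no_exclusion[OF t assms(1), where U = "{..<ereal w}"])
    show "\<forall>\<^sub>F \<delta> in at_right 0.
        (\<lambda>X. (mu_R \<pi> (N \<delta>) \<delta> X - ereal (deriv b \<theta>)) / ereal (ci_rate N \<delta>)) \<in> borel_measurable P"
      using eventually_endpoints_measurable by eventually_elim auto
    show "\<forall>\<^sub>F \<delta> in at_right 0. \<forall>X\<in>space P.
        (mu_R \<pi> (N \<delta>) \<delta> X - ereal (deriv b \<theta>)) / ereal (ci_rate N \<delta>) \<in> {..<ereal w} \<longrightarrow>
        ereal (deriv b (\<theta> + s / ?v * ci_rate N \<delta>)) \<notin> {mu_L \<pi> (N \<delta>) \<delta> X .. mu_R \<pi> (N \<delta>) \<delta> X}"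
      using slope eventually_rate
    proof eventually_elim
      case (elim \<delta>)
      have "u < ereal (deriv b (\<theta> + s / ?v * ci_rate N \<delta>))"
        if "(u - ereal (deriv b \<theta>)) / ereal (ci_rate N \<delta>) < ereal w" for u
        using elim that by (cases u) (auto simp: field_simps)
      then show ?case by (force simp: not_le)
    qed
  qed (use w in auto)
qed

text \<open>
  The mirror image: the alternative is tilted in the negative direction, so that its mean lies below
  the lower endpoint.
\<close>

lemma lower_rate_ge:
  assumes "tendsto_in_prob P
      (\<lambda>\<delta> X. (ereal (deriv b \<theta>) - mu_L \<pi> (N \<delta>) \<delta> X) / ereal (ci_rate N \<delta>)) (ereal q) (at_right 0)"
    and q: "0 \<le> q"
  shows "sqrt (2 * deriv (deriv b) \<theta>) \<le> q"
proof (rule ccontr)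
  let ?v = "deriv (deriv b) \<theta>"
  assume "\<not> sqrt (2 * ?v) \<le> q"
  then obtain s where s: "q < s" "s < sqrt (2 * ?v)" using dense[of q] by force
  then have "0 < sqrt (2 * ?v)" using q by linarith
  then have v: "0 < ?v" by simp
  have "s\<^sup>2 < (sqrt (2 * ?v))\<^sup>2" using s q by (intro power_strict_mono) auto
  with v have t: "(- s / ?v)\<^sup>2 * (?v / 2) < 1"
    by (simp add: power_divide power2_eq_square field_simps)
  obtain w where w: "q < w" "w < s" using dense[OF s(1)] by auto
  have "((\<lambda>\<delta>. (deriv b (\<theta> + - s / ?v * ci_rate N \<delta>) - deriv b \<theta>) / ci_rate N \<delta>) \<longlongrightarrow> - s / ?v * ?v) (at_right 0)"
    by (rule mean_scaling[OF \<theta> rate_tendsto_0 eventually_rate_nonzero])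
  then have slope: "\<forall>\<^sub>F \<delta> in at_right 0. (deriv b (\<theta> + - s / ?v * ci_rate N \<delta>) - deriv b \<theta>) / ci_rate N \<delta> < - w"
    using v w by (intro order_tendstoD) auto
  show False
  proof (rule no_exclusion[OF t assms(1), where U = "{..<ereal w}"])
    show "\<forall>\<^sub>F \<delta> in at_right 0.
        (\<lambda>X. (ereal (deriv b \<theta>) - mu_L \<pi> (N \<delta>) \<delta> X) / ereal (ci_rate N \<delta>)) \<in> borel_measurable P"
      using eventually_endpoints_measurable by eventually_elim auto
    show "\<forall>\<^sub>F \<delta> in at_right 0. \<forall>X\<in>space P.
        (ereal (deriv b \<theta>) - mu_L \<pi> (N \<delta>) \<delta> X) / ereal (ci_rate N \<delta>) \<in> {..<ereal w} \<longrightarrow>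
        ereal (deriv b (\<theta> + - s / ?v * ci_rate N \<delta>)) \<notin> {mu_L \<pi> (N \<delta>) \<delta> X .. mu_R \<pi> (N \<delta>) \<delta> X}"
      using slope eventually_rate
    proof eventually_elim
      case (elim \<delta>)
      have "ereal (deriv b (\<theta> + - s / ?v * ci_rate N \<delta>)) < l"
        if "(ereal (deriv b \<theta>) - l) / ereal (ci_rate N \<delta>) < ereal w" for l
        using elim that by (cases l) (auto simp: field_simps)
      then show ?case by (force simp: not_le)
    qed
  qed (use w in auto)
qed

end

end

end

section \<open>The limiting width\<close>

text \<open>
  The identity also holds for infinite endpoints, because \<open>\<infinity> + (- \<infinity>) = \<infinity>\<close>
  in the extended reals.
\<close>

lemma ereal_width_split:
  fixes l u :: ereal and r m :: real
  assumes "0 < r"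
  shows "(u - l) / ereal r = (ereal m - l) / ereal r + (u - ereal m) / ereal r"
  using assms by (cases l; cases u) (auto simp: field_simps)

theorem theorem6:
  fixes \<xi> \<nu> :: "real measure" and b :: "real \<Rightarrow> real"
    and N :: "real \<Rightarrow> nat" and \<pi> :: policy
  assumes "canonical_exp_family \<xi> b"
    and "\<nu> \<in> exp_family \<xi> b"
    and "sample_size_fun N"
    and "filterlim (\<lambda>\<delta>. real (N \<delta>) / ln (1 / \<delta>)) at_top (at_right 0)"
    and "\<pi> \<in> rate_stable_policies \<xi> b N \<nu>"
  shows "\<exists>q::real. 0 \<le> q \<and>
    tendsto_in_prob (iid_seq \<nu>)
      (\<lambda>\<delta> X. (mu_R \<pi> (N \<delta>) \<delta> X - mu_L \<pi> (N \<delta>) \<delta> X) / ereal (ci_rate N \<delta>))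
      (ereal q) (at_right 0) \<and>
    sqrt 8 * std_dev \<nu> \<le> q"
proof -
  obtain \<theta> where \<theta>: "\<theta> \<in> natural_param_space \<xi>" and \<nu>: "\<nu> = exp_family_dist \<xi> b \<theta>"
    using assms(2) by (auto simp: exp_family_def)
  note mean = mean_p[OF assms(1) \<theta>, folded \<nu>]
  have \<pi>: "\<pi> \<in> CI_policies \<xi> b"
    using assms(5) by (auto simp: rate_stable_policies_def stable_policies_def)
  let ?v = "deriv (deriv b) \<theta>"
  let ?L = "\<lambda>\<delta> X. (ereal (mean \<nu>) - mu_L \<pi> (N \<delta>) \<delta> X) / ereal (ci_rate N \<delta>)"
  let ?R = "\<lambda>\<delta> X. (mu_R \<pi> (N \<delta>) \<delta> X - ereal (mean \<nu>)) / ereal (ci_rate N \<delta>)"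
  obtain qL qR where q: "0 \<le> qL" "0 \<le> qR"
    and L: "tendsto_in_prob (iid_seq \<nu>) ?L (ereal qL) (at_right 0)"
    and R: "tendsto_in_prob (iid_seq \<nu>) ?R (ereal qR) (at_right 0)"
    using assms(4,5) by (auto simp: rate_stable_policies_def)
  have qL: "sqrt (2 * ?v) \<le> qL"
    using L q by (intro lower_rate_ge[OF assms(1,4) \<pi> assms(3) \<theta>]) (simp_all add: mean flip: \<nu>)
  have qR: "sqrt (2 * ?v) \<le> qR"
    using R q by (intro upper_rate_ge[OF assms(1,4) \<pi> assms(3) \<theta>]) (simp_all add: mean flip: \<nu>)
  have "sqrt 8 * std_dev \<nu> = 2 * sqrt (2 * (\<integral>x. (x - mean \<nu>)\<^sup>2 \<partial>\<nu>))"
    using real_sqrt_mult[of 4 2] by (simp add: std_dev_def real_sqrt_mult)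
  also have "\<dots> \<le> 2 * sqrt (2 * ?v)"
    using variance_p_le[OF assms(1) \<theta>, folded \<nu>] by simp
  also have "\<dots> \<le> qL + qR" using qL qR by simp
  finally have bound: "sqrt 8 * std_dev \<nu> \<le> qL + qR" .
  have meas: "\<forall>\<^sub>F \<delta> in at_right 0. ?L \<delta> \<in> borel_measurable (iid_seq \<nu>) \<and> ?R \<delta> \<in> borel_measurable (iid_seq \<nu>)"
    using eventually_endpoints_measurable[OF assms(1,4) \<pi> assms(3) \<theta>, folded \<nu>]
    by eventually_elim auto
  have split: "\<forall>\<^sub>F \<delta> in at_right 0. \<forall>X\<in>space (iid_seq \<nu>).
      (mu_R \<pi> (N \<delta>) \<delta> X - mu_L \<pi> (N \<delta>) \<delta> X) / ereal (ci_rate N \<delta>) = ?L \<delta> X + ?R \<delta> X"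
    using eventually_rate[OF assms(1,4)]
    by eventually_elim (intro ballI ereal_width_split, auto)
  have "prob_space (iid_seq \<nu>)"
    unfolding \<nu> by (rule prob_space_iid_seq[OF prob_space_p[OF assms(1) \<theta>]])
  then have "tendsto_in_prob (iid_seq \<nu>)
      (\<lambda>\<delta> X. (mu_R \<pi> (N \<delta>) \<delta> X - mu_L \<pi> (N \<delta>) \<delta> X) / ereal (ci_rate N \<delta>))
      (ereal (qL + qR)) (at_right 0)"
    by (rule tendsto_in_prob_add[OF _ L R meas split])
  with bound q show ?thesis by (intro exI[of _ "qL + qR"]) simp
qed

end
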